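(* Let $(A,[\cdot,\cdot],\alpha)$ be a multiplicative Hom-Lie algebra, $(V,\rho,\beta)$ a representation of it, $\mathcal F$ a $2$-cocycle with respect to $(V,\rho,\beta)$, and $T:V\to A$ an $\mathcal F$-twisted $\mathcal O$-operator on $(A,[\cdot,\cdot],\alpha)$ with respect to $(V,\rho,\beta)$. Put $$[\![x,y,z]\!]_T=[[x,y],\alpha(z)],\quad \theta_\rho(x,y)=\rho(\alpha(y))\rho(x),\quad \mathcal G(x,y,z)=\mathcal F([x,y],\alpha(z))-\rho(\alpha(z))\mathcal F(x,y).$$ Then $T$ is an $(\mathcal F,\mathcal G)$-twisted $\mathcal O$-operator on the induced Hom-Lie-Yamaguti algebra $(A,[\cdot,\cdot],[\![\cdot,\cdot,\cdot]\!]_T,\alpha)$ with respect to the representation $(V,\rho,\theta_\rho,\beta)$.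
   Context: All linear spaces are finite-dimensional over a field $\mathbb K$ of characteristic $0$. $\circlearrowleft_{x,y,z}$ denotes the sum over cyclic permutations of $(x,y,z)$. Hom-Lie algebra $(A,[\cdot,\cdot],\alpha)$: bilinear skew-symmetric bracket, linear $\alpha:A\to A$, with $\circlearrowleft_{x,y,z}[\alpha(x),[y,z]]=0$; multiplicative if $\alpha([x,y])=[\alpha(x),\alpha(y)]$. A representation $(V,\rho,\beta)$: a linear space $V$, $\beta\in End(V)$, linear $\rho:A\to End(V)$ with $\rho(\alpha(x))\beta=\beta\rho(x)$ and $\rho([x,y])\beta=\rho(\alpha(x))\rho(y)-\rho(\alpha(y))\rho(x)$. A $2$-cocycle: a skew-symmetric bilinear $\mathcal F:A\times A\to V$ with $\mathcal F(\alpha(x),\alpha(y))=\beta\mathcal F(x,y)$ and $\circlearrowleft_{x,y,z}\big(\rho(\alpha(x))\mathcal F(y,z)+\mathcal F(\alpha(x),[y,z])\big)=0$. An $\mathcal F$-twisted $\mathcal O$-operator on a Hom-Lie algebra with respect to $(V,\rho,\beta)$ is a linear map $T:V\to A$ with $T\beta=\alpha T$ and $[Tu,Tv]=T\big(\rho(Tu)v-\rho(Tv)u+\mathcal F(Tu,Tv)\big)$ for all $u,v\in V$. For a multiplicative Hom-Lie algebra, $(A,[\cdot,\cdot],[\![\cdot,\cdot,\cdot]\!]_T,\alpha)$ is a Hom-Lie-Yamaguti algebra (the induced one), $(V,\rho,\theta_\rho,\beta)$ is a representation of it, and $(\mathcal F,\mathcal G)$ is a $(2,3)$-cocycle of it with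 coefficients in this representation. For a representation $(V,\rho,\theta,\beta)$ of a Hom-Lie-Yamaguti algebra $(A,[\cdot,\cdot],[\![\cdot,\cdot,\cdot]\!],\alpha)$ put $D(x,y)=\theta(y,x)-\theta(x,y)+\rho(\alpha(x))\rho(y)-\rho(\alpha(y))\rho(x)-\rho([x,y])\beta$. An $(\mathcal F,\mathcal G)$-twisted $\mathcal O$-operator on it with respect to $(V,\rho,\theta,\beta)$ is a linear map $T:V\to A$ such that for all $u,v,w\in V$: $T\beta=\alpha T$; $[Tu,Tv]=T\big(\rho(Tu)v-\rho(Tv)u+\mathcal F(Tu,Tv)\big)$; and $$[\![Tu,Tv,Tw]\!]=T\big(D(Tu,Tv)w+\theta(Tv,Tw)u-\theta(Tu,Tw)v+\mathcal G(Tu,Tv,Tw)\big).$$ *)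

theory Defs
  imports Complex_Main
begin

definition bilinear_map ::
  "('k::field \<Rightarrow> 'a::ab_group_add \<Rightarrow> 'a) \<Rightarrow> ('k \<Rightarrow> 'b::ab_group_add \<Rightarrow> 'b) \<Rightarrow>
   ('k \<Rightarrow> 'c::ab_group_add \<Rightarrow> 'c) \<Rightarrow> ('a \<Rightarrow> 'b \<Rightarrow> 'c) \<Rightarrow> bool"
where
  "bilinear_map s1 s2 s3 f \<longleftrightarrow>
     (\<forall>x. Vector_Spaces.linear s2 s3 (f x)) \<and>
     (\<forall>y. Vector_Spaces.linear s1 s3 (\<lambda>x. f x y))"

locale hom_lie_algebra =
  fixes sA :: "'k::field_char_0 \<Rightarrow> 'a::ab_group_add \<Rightarrow> 'a"
    and br :: "'a \<Rightarrow> 'a \<Rightarrow> 'a"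
    and \<alpha> :: "'a \<Rightarrow> 'a"
  assumes finite_dim_A: "\<exists>B. finite_dimensional_vector_space sA B"
    and bilinear_br: "bilinear_map sA sA sA br"
    and skew_br: "br x y = - br y x"
    and linear_alpha: "Vector_Spaces.linear sA sA \<alpha>"
    and hom_jacobi: "br (\<alpha> x) (br y z) + br (\<alpha> y) (br z x) + br (\<alpha> z) (br x y) = 0"

locale multiplicative_hom_lie_algebra = hom_lie_algebra +
  assumes multiplicative: "\<alpha> (br x y) = br (\<alpha> x) (\<alpha> y)"

text \<open>A linear map from \<open>A\<close> to \<open>End(V)\<close> is encoded in curried form, as a family of
  endomorphisms \<open>\<rho> x\<close> of \<open>V\<close> such that \<open>\<rho> x v\<close> is also linear in \<open>x\<close>.\<close>

locale hom_lie_representation = hom_lie_algebra sA br \<alpha>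
  for sA :: "'k::field_char_0 \<Rightarrow> 'a::ab_group_add \<Rightarrow> 'a"
    and br :: "'a \<Rightarrow> 'a \<Rightarrow> 'a"
    and \<alpha> :: "'a \<Rightarrow> 'a" +
  fixes sV :: "'k \<Rightarrow> 'v::ab_group_add \<Rightarrow> 'v"
    and \<rho> :: "'a \<Rightarrow> 'v \<Rightarrow> 'v"
    and \<beta> :: "'v \<Rightarrow> 'v"
  assumes finite_dim_V: "\<exists>B. finite_dimensional_vector_space sV B"
    and linear_beta: "Vector_Spaces.linear sV sV \<beta>"
    and linear_rho: "bilinear_map sA sV sV \<rho>"
    and rho_alpha: "\<rho> (\<alpha> x) \<circ> \<beta> = \<beta> \<circ> \<rho> x"
    and rho_br: "\<rho> (br x y) (\<beta> v) = \<rho> (\<alpha> x) (\<rho> y v) - \<rho> (\<alpha> y) (\<rho> x v)"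

locale hom_lie_2_cocycle = hom_lie_representation sA br \<alpha> sV \<rho> \<beta>
  for sA :: "'k::field_char_0 \<Rightarrow> 'a::ab_group_add \<Rightarrow> 'a"
    and br :: "'a \<Rightarrow> 'a \<Rightarrow> 'a"
    and \<alpha> :: "'a \<Rightarrow> 'a"
    and sV :: "'k \<Rightarrow> 'v::ab_group_add \<Rightarrow> 'v"
    and \<rho> :: "'a \<Rightarrow> 'v \<Rightarrow> 'v"
    and \<beta> :: "'v \<Rightarrow> 'v" +
  fixes F :: "'a \<Rightarrow> 'a \<Rightarrow> 'v"
  assumes bilinear_F: "bilinear_map sA sA sV F"
    and skew_F: "F x y = - F y x"
    and F_alpha: "F (\<alpha> x) (\<alpha> y) = \<beta> (F x y)"
    and F_cocycle:
      "(\<rho> (\<alpha> x) (F y z) + F (\<alpha> x) (br y z)) +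
       (\<rho> (\<alpha> y) (F z x) + F (\<alpha> y) (br z x)) +
       (\<rho> (\<alpha> z) (F x y) + F (\<alpha> z) (br x y)) = 0"

definition twisted_O_operator ::
  "('k::field_char_0 \<Rightarrow> 'a::ab_group_add \<Rightarrow> 'a) \<Rightarrow> ('a \<Rightarrow> 'a \<Rightarrow> 'a) \<Rightarrow> ('a \<Rightarrow> 'a) \<Rightarrow>
   ('k \<Rightarrow> 'v::ab_group_add \<Rightarrow> 'v) \<Rightarrow> ('a \<Rightarrow> 'v \<Rightarrow> 'v) \<Rightarrow> ('v \<Rightarrow> 'v) \<Rightarrow>
   ('a \<Rightarrow> 'a \<Rightarrow> 'v) \<Rightarrow> ('v \<Rightarrow> 'a) \<Rightarrow> bool"
where
  "twisted_O_operator sA br \<alpha> sV \<rho> \<beta> F T \<longleftrightarrow>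
     Vector_Spaces.linear sV sA T \<and>
     T \<circ> \<beta> = \<alpha> \<circ> T \<and>
     (\<forall>u v. br (T u) (T v) = T (\<rho> (T u) v - \<rho> (T v) u + F (T u) (T v)))"

definition hom_LY_D ::
  "('a \<Rightarrow> 'a \<Rightarrow> 'a) \<Rightarrow> ('a \<Rightarrow> 'a) \<Rightarrow> ('a \<Rightarrow> 'v \<Rightarrow> 'v) \<Rightarrow> ('a \<Rightarrow> 'a \<Rightarrow> 'v \<Rightarrow> 'v) \<Rightarrow> ('v \<Rightarrow> 'v) \<Rightarrow>
   'a \<Rightarrow> 'a \<Rightarrow> 'v::ab_group_add \<Rightarrow> 'v"
where
  "hom_LY_D br \<alpha> \<rho> \<theta> \<beta> x y v =
     \<theta> y x v - \<theta> x y v + \<rho> (\<alpha> x) (\<rho> y v) - \<rho> (\<alpha> y) (\<rho> x v) - \<rho> (br x y) (\<beta> v)"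

text \<open>Here \<open>tri\<close> is the ternary bracket of the Hom-Lie-Yamaguti algebra.\<close>

definition hom_LY_twisted_O_operator ::
  "('k::field_char_0 \<Rightarrow> 'a::ab_group_add \<Rightarrow> 'a) \<Rightarrow>
   ('a \<Rightarrow> 'a \<Rightarrow> 'a) \<Rightarrow> ('a \<Rightarrow> 'a \<Rightarrow> 'a \<Rightarrow> 'a) \<Rightarrow> ('a \<Rightarrow> 'a) \<Rightarrow>
   ('k \<Rightarrow> 'v::ab_group_add \<Rightarrow> 'v) \<Rightarrow>
   ('a \<Rightarrow> 'v \<Rightarrow> 'v) \<Rightarrow> ('a \<Rightarrow> 'a \<Rightarrow> 'v \<Rightarrow> 'v) \<Rightarrow> ('v \<Rightarrow> 'v) \<Rightarrow>
   ('a \<Rightarrow> 'a \<Rightarrow> 'v) \<Rightarrow> ('a \<Rightarrow> 'a \<Rightarrow> 'a \<Rightarrow> 'v) \<Rightarrow> ('v \<Rightarrow> 'a) \<Rightarrow> bool"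
where
  "hom_LY_twisted_O_operator sA br tri \<alpha> sV \<rho> \<theta> \<beta> F G T \<longleftrightarrow>
     Vector_Spaces.linear sV sA T \<and>
     T \<circ> \<beta> = \<alpha> \<circ> T \<and>
     (\<forall>u v. br (T u) (T v) = T (\<rho> (T u) v - \<rho> (T v) u + F (T u) (T v))) \<and>
     (\<forall>u v w. tri (T u) (T v) (T w) =
        T (hom_LY_D br \<alpha> \<rho> \<theta> \<beta> (T u) (T v) w + \<theta> (T v) (T w) u - \<theta> (T u) (T w) v
           + G (T u) (T v) (T w)))"

definition induced_tri :: "('a \<Rightarrow> 'a \<Rightarrow> 'a) \<Rightarrow> ('a \<Rightarrow> 'a) \<Rightarrow> 'a \<Rightarrow> 'a \<Rightarrow> 'a \<Rightarrow> 'a" where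
  "induced_tri br \<alpha> x y z = br (br x y) (\<alpha> z)"

definition induced_theta ::
  "('a \<Rightarrow> 'a) \<Rightarrow> ('a \<Rightarrow> 'v \<Rightarrow> 'v) \<Rightarrow> 'a \<Rightarrow> 'a \<Rightarrow> 'v \<Rightarrow> 'v" where
  "induced_theta \<alpha> \<rho> x y = \<rho> (\<alpha> y) \<circ> \<rho> x"

definition induced_G ::
  "('a \<Rightarrow> 'a \<Rightarrow> 'a) \<Rightarrow> ('a \<Rightarrow> 'a) \<Rightarrow> ('a \<Rightarrow> 'v \<Rightarrow> 'v) \<Rightarrow> ('a \<Rightarrow> 'a \<Rightarrow> 'v) \<Rightarrow>
   'a \<Rightarrow> 'a \<Rightarrow> 'a \<Rightarrow> 'v::ab_group_add" where
  "induced_G br \<alpha> \<rho> F x y z = F (br x y) (\<alpha> z) - \<rho> (\<alpha> z) (F x y)"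

end

theory Submission
  imports Defs
begin

text \<open>Only the ternary identity is new. By the binary identity [Tu,Tv] = Tm, with m the
  argument of T there, and \<alpha>(Tw) = T(\<beta>w); so [[Tu,Tv],\<alpha>(Tw)] is again a bracket
  of two values of T, and the binary identity applies once more, to m and \<beta>w. Expanding m in
  the result gives exactly the required terms, since for \<theta>_\<rho> the operator D(x,y)
  collapses to \<rho>([x,y])\<beta>.\<close>

theorem proposition3p11:
  fixes sA :: "'k::field_char_0 \<Rightarrow> 'a::ab_group_add \<Rightarrow> 'a"
    and br :: "'a \<Rightarrow> 'a \<Rightarrow> 'a"
    and \<alpha> :: "'a \<Rightarrow> 'a"
    and sV :: "'k \<Rightarrow> 'v::ab_group_add \<Rightarrow> 'v"
    and \<rho> :: "'a \<Rightarrow> 'v \<Rightarrow> 'v"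
    and \<beta> :: "'v \<Rightarrow> 'v"
    and F :: "'a \<Rightarrow> 'a \<Rightarrow> 'v"
    and T :: "'v \<Rightarrow> 'a"
  assumes "multiplicative_hom_lie_algebra sA br \<alpha>"
    and "hom_lie_representation sA br \<alpha> sV \<rho> \<beta>"
    and "hom_lie_2_cocycle sA br \<alpha> sV \<rho> \<beta> F"
    and "twisted_O_operator sA br \<alpha> sV \<rho> \<beta> F T"
  shows "hom_LY_twisted_O_operator sA br (induced_tri br \<alpha>) \<alpha>
           sV \<rho> (induced_theta \<alpha> \<rho>) \<beta> F (induced_G br \<alpha> \<rho> F) T"
proof -
  interpret C: hom_lie_2_cocycle sA br \<alpha> sV \<rho> \<beta> F by fact
  have lin: "Vector_Spaces.linear sV sA T"
    and comm: "T \<circ> \<beta> = \<alpha> \<circ> T"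
    and op: "br (T u) (T v) = T (\<rho> (T u) v - \<rho> (T v) u + F (T u) (T v))" for u v
    using assms(4) unfolding twisted_O_operator_def by blast+
  have \<alpha>_T: "\<alpha> (T w) = T (\<beta> w)" for w
    using comm by (metis comp_apply)
  have linear_rho: "Vector_Spaces.linear sV sV (\<rho> x)" for x
    using C.linear_rho by (simp add: bilinear_map_def)
  have rho_add: "\<rho> x (v + w) = \<rho> x v + \<rho> x w"
    and rho_diff: "\<rho> x (v - w) = \<rho> x v - \<rho> x w" for x v w
    using linear_rho[of x]
    by (simp_all add: Vector_Spaces.linear_iff_module_hom module_hom.add module_hom.diff)
  have tri: "br (br (T u) (T v)) (\<alpha> (T w)) =
      T (hom_LY_D br \<alpha> \<rho> (induced_theta \<alpha> \<rho>) \<beta> (T u) (T v) w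
         + induced_theta \<alpha> \<rho> (T v) (T w) u - induced_theta \<alpha> \<rho> (T u) (T w) v
         + induced_G br \<alpha> \<rho> F (T u) (T v) (T w))" for u v w
  proof -
    define m where "m = \<rho> (T u) v - \<rho> (T v) u + F (T u) (T v)"
    have T_m: "br (T u) (T v) = T m"
      by (simp add: m_def op)
    \<comment> \<open>With P = \<rho>(\<alpha> x)\<rho>(y) - \<rho>(\<alpha> y)\<rho>(x), the two
      \<theta>-terms of D contribute one P, the explicit terms another, and the subtracted
      \<rho>([x,y])\<beta> equals P by \<open>C.rho_br\<close>; what remains is P =
      \<rho>([x,y])\<beta>. Flipping \<open>T_m\<close> exposes the bracket to which
      \<open>C.rho_br\<close> applies.\<close>
    have D: "hom_LY_D br \<alpha> \<rho> (induced_theta \<alpha> \<rho>) \<beta> (T u) (T v) w = \<rho> (T m) (\<beta> w)"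
      by (simp add: hom_LY_D_def induced_theta_def C.rho_br flip: T_m)
    have "br (br (T u) (T v)) (\<alpha> (T w)) =
        T (\<rho> (T m) (\<beta> w) - \<rho> (\<alpha> (T w)) m + F (T m) (\<alpha> (T w)))"
      \<comment> \<open>This is \<open>op\<close> at the pair \<open>m\<close>,
        \<open>\<beta> w\<close>.\<close>
      unfolding T_m \<alpha>_T by (rule op)
    \<comment> \<open>The F-summand of \<open>m\<close> yields the second term of G; the first is
      \<open>F (T m) (\<alpha> (T w))\<close>.\<close>
    also have "\<rho> (\<alpha> (T w)) m = induced_theta \<alpha> \<rho> (T u) (T w) v
        - induced_theta \<alpha> \<rho> (T v) (T w) u + \<rho> (\<alpha> (T w)) (F (T u) (T v))"
      by (simp add: m_def rho_add rho_diff induced_theta_def)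
    finally show ?thesis
      by (simp add: D induced_G_def T_m algebra_simps)
  qed
  show ?thesis
    unfolding hom_LY_twisted_O_operator_def induced_tri_def
    using lin comm op tri by blast
qed

end
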